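(* Let $\Sigma$ be a finite alphabet of non-negative integer letters containing the letter $0$, and let $m,n$ be positive integers. Consider the following algorithm. (1) Start with the word $w=0^n$. (2) Append to the end of the current word $w$ the lexicographically largest word $x\in\Sigma^m$ such that the suffix of length $n$ of the new word $wx$ has not yet appeared as a factor at a modulo $m$ position in the current word $w$. (3) Repeat step (2) until no word $x\in\Sigma^m$ satisfying the condition exists. Then the word $w$ obtained when the algorithm stops is an $m$-shift de Bruijn sequence of order $n$ over $\Sigma$.
   Context: $\Sigma^n$ denotes the set of all words of length $n$ over $\Sigma$, and $0^n$ is the word of $n$ zeros. Letters are ordered as integers, so $0$ is the smallest letter, and words of the same length are compared lexicographically. For a word $w=a_1a_2\cdots a_\ell$, write $w[i..j]=a_i\cdots a_j$. A word $u$ of length $n$ appears in $w$ (as a factor) at a modulo $m$ position if $u=w[im+1..im+n]$ for some integer $i\ge 0$; distinct values of $i$ count as distinct appearances. An $m$-shift de Bruijn sequence of order $n$ over $\Sigma$ is a word $w$ over $\Sigma$, of length $m|\Sigma|^n+(n-m)$, such that each word in $\Sigma^n$ appears exactly once in $w$ as a factor at a modulo $m$ position. *)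

theory Defs
  imports Main "HOL-Library.List_Lexorder" "HOL-Library.While_Combinator"
begin

definition words :: "nat set \<Rightarrow> nat \<Rightarrow> nat list set" where
  "words A k = {u. set u \<subseteq> A \<and> length u = k}"

definition occurs_at :: "nat \<Rightarrow> nat list \<Rightarrow> nat list \<Rightarrow> nat \<Rightarrow> bool" where
  "occurs_at m u w i \<longleftrightarrow>
     i * m + length u \<le> length w \<and> take (length u) (drop (i * m) w) = u"

definition appears :: "nat \<Rightarrow> nat list \<Rightarrow> nat list \<Rightarrow> bool" where
  "appears m u w \<longleftrightarrow> (\<exists>i. occurs_at m u w i)"

definition shift_de_bruijn :: "nat set \<Rightarrow> nat \<Rightarrow> nat \<Rightarrow> nat list \<Rightarrow> bool" where
  "shift_de_bruijn A m n w \<longleftrightarrow>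
     set w \<subseteq> A \<and>
     int (length w) = int m * int (card A) ^ n + (int n - int m) \<and>
     (\<forall>u \<in> words A n. \<exists>!i. occurs_at m u w i)"

definition suffix_of_length :: "nat \<Rightarrow> nat list \<Rightarrow> nat list" where
  "suffix_of_length n w = drop (length w - n) w"

definition extensions :: "nat set \<Rightarrow> nat \<Rightarrow> nat \<Rightarrow> nat list \<Rightarrow> nat list set" where
  "extensions A m n w =
     {x \<in> words A m. \<not> appears m (suffix_of_length n (w @ x)) w}"

text \<open>The maximum is taken in the lexicographic order on lists provided by
  \<^theory>\<open>HOL-Library.List_Lexorder\<close>; it is used only when the set of extensions is
  nonempty, and that set is finite for a finite alphabet.\<close>

definition greedy_step :: "nat set \<Rightarrow> nat \<Rightarrow> nat \<Rightarrow> nat list \<Rightarrow> nat list" where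
  "greedy_step A m n w = w @ Max (extensions A m n w)"

text \<open>The result is \<^term>\<open>None\<close> exactly if the loop does not terminate.\<close>

definition greedy_algorithm :: "nat set \<Rightarrow> nat \<Rightarrow> nat \<Rightarrow> nat list option" where
  "greedy_algorithm A m n =
     while_option (\<lambda>w. extensions A m n w \<noteq> {}) (greedy_step A m n) (replicate n 0)"

end

theory Submission
  imports Defs
begin

text \<open>For \<open>m < n\<close>, regard the words of length \<open>n\<close> as the edges of a graph on the words of length
  \<open>n - m\<close>, the edge \<open>u\<close> leading from its prefix to its suffix.  Every vertex has in- and out-degree
  \<open>|A| ^ m\<close>, and the algorithm walks along a trail.  The trail gets stuck at a vertex all of whose
  outgoing edges are used; counting shows that this must be the initial vertex \<open>0 \<dots> 0\<close>, so the trail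
  is closed.  At every other vertex the edge labelled \<open>0 \<dots> 0\<close> is used last.  Hence if all edges
  out of the target of \<open>v 0 \<dots> 0\<close> are used, then by balance so are all edges into it, in particular
  \<open>v 0 \<dots> 0\<close>, and therefore all edges out of \<open>v\<close>.  Appending zeros leads from any vertex to the
  initial one, so every edge is used.  For \<open>m \<ge> n\<close> each word of length \<open>n\<close> can be appended at any
  time.\<close>

section \<open>Words of fixed length\<close>

lemma finite_words: "finite A \<Longrightarrow> finite (words A k)"
  by (simp add: words_def finite_lists_length_eq)

lemma card_words: "finite A \<Longrightarrow> card (words A k) = card A ^ k"
  by (simp add: words_def card_lists_length_eq)

lemma append_in_words: "u \<in> words A k \<Longrightarrow> v \<in> words A l \<Longrightarrow> u @ v \<in> words A (k + l)"
  by (auto simp: words_def)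

lemma take_in_words: "u \<in> words A k \<Longrightarrow> l \<le> k \<Longrightarrow> take l u \<in> words A l"
  by (auto simp: words_def dest: in_set_takeD)

lemma drop_in_words: "u \<in> words A k \<Longrightarrow> drop l u \<in> words A (k - l)"
  by (auto simp: words_def dest: in_set_dropD)

lemma replicate_in_words: "a \<in> A \<Longrightarrow> replicate k a \<in> words A k"
  by (auto simp: words_def)

text \<open>Makes the zero block the least one, so the greedy choice falls on it only when every
  other block is excluded.\<close>

lemma replicate_0_le:
  fixes y :: "nat list"
  shows "replicate (length y) 0 \<le> y"
  by (induction y) auto

lemma take_drop_in_words:
  assumes "w \<in> words A l" and "i + n \<le> l"
  shows "take n (drop i w) \<in> words A n"
  using drop_in_words[OF assms(1), of i] assms(2) by (intro take_in_words) auto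

section \<open>Trails in the graph of words\<close>

text \<open>Here \<open>s i\<close> and \<open>t i\<close> are the source and target of the
  \<open>i\<close>-th edge. Each arrival is also the next departure, so the two counts at
  \<open>v\<close> differ only by the first departure and the last arrival.\<close>

lemma trail_balance:
  assumes step: "\<And>i. i < k \<Longrightarrow> t i = s (Suc i)"
  shows "card {i \<in> {..k}. t i = v} + of_bool (s 0 = v)
    = card {i \<in> {..k}. s i = v} + of_bool (t k = (v :: 'a))"
proof -
  have count: "card {i \<in> {..k}. P i} = (\<Sum>i\<le>k. of_bool (P i))" for P :: "nat \<Rightarrow> bool"
    by (simp add: of_bool_def sum.If_cases Int_def)
  have "(\<Sum>i\<le>k. of_bool (t i = v)) + of_bool (s 0 = v)
      = (\<Sum>i\<le>k. of_bool (s i = v)) + (of_bool (t k = v) :: nat)"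
    using step
  proof (induction k)
    case (Suc k)
    have "(\<Sum>i\<le>k. of_bool (t i = v)) + of_bool (s 0 = v)
      = (\<Sum>i\<le>k. of_bool (s i = v)) + (of_bool (t k = v) :: nat)"
      by (rule Suc.IH) (simp add: Suc.prems)
    moreover have "t k = s (Suc k)" by (simp add: Suc.prems)
    ultimately show ?case by (simp only: sum.atMost_Suc)
  qed auto
  then show ?thesis by (simp only: count)
qed

text \<open>Stated for an abstract trail \<open>e\<close>. The greedy choice enters only through
  \<open>last\<close>: away from the zero vertex, a used zero edge means that all edges with the
  same source are used.\<close>

lemma greedy_trail_covers:
  fixes e :: "nat \<Rightarrow> nat list"
  assumes fin: "finite A" and zero: "0 \<in> A" and "0 < m" and mn: "m < n"
    and edge: "\<And>i. i \<le> k \<Longrightarrow> e i \<in> words A n"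
    and inj: "inj_on e {..k}"
    and link: "\<And>i. i < k \<Longrightarrow> drop m (e i) = take (n - m) (e (Suc i))"
    and start: "e 0 = replicate n 0"
    and stuck: "\<And>x. x \<in> words A m \<Longrightarrow> drop m (e k) @ x \<in> e ` {..k}"
    and last: "\<And>v x. v \<noteq> replicate (n - m) 0 \<Longrightarrow> v @ replicate m 0 \<in> e ` {..k}
      \<Longrightarrow> x \<in> words A m \<Longrightarrow> v @ x \<in> e ` {..k}"
  shows "words A n \<subseteq> e ` {..k}"
proof -
  define out_edges where "out_edges v = (\<lambda>x. v @ x) ` words A m" for v
  define in_edges where "in_edges v = (\<lambda>x. x @ v) ` words A m" for v
  let ?s = "\<lambda>i. take (n - m) (e i)" and ?t = "\<lambda>i. drop m (e i)" and ?z = "replicate (n - m) (0::nat)"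
  have fin_edges: "finite (out_edges v)" "finite (in_edges v)" for v
    using fin by (auto simp: out_edges_def in_edges_def finite_words)
  have card_edges: "card (out_edges v) = card A ^ m" "card (in_edges v) = card A ^ m" for v
    using fin by (auto simp: out_edges_def in_edges_def card_image inj_on_def card_words)
  \<comment> \<open>Since \<open>e\<close> is injective, the number of departures from
    \<open>v\<close> is the number of used edges out of \<open>v\<close>.\<close>
  have out_count: "card {i \<in> {..k}. ?s i = v} = card (e ` {..k} \<inter> out_edges v)"
    if v: "v \<in> words A (n - m)" for v
  proof -
    have "e i \<in> out_edges v \<longleftrightarrow> ?s i = v" if "i \<le> k" for i
    proof
      assume "?s i = v"
      moreover have "drop (n - m) (e i) \<in> words A m"
        using drop_in_words[OF edge[OF that], of "n - m"] mn by simp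
      ultimately show "e i \<in> out_edges v"
        unfolding out_edges_def by (intro image_eqI[of _ _ "drop (n - m) (e i)"]) auto
    qed (use v in \<open>auto simp: out_edges_def words_def\<close>)
    then have "e ` {..k} \<inter> out_edges v = e ` {i \<in> {..k}. ?s i = v}" by auto
    moreover have "inj_on e {i \<in> {..k}. ?s i = v}"
      using inj by (rule inj_on_subset) auto
    ultimately show ?thesis by (simp add: card_image)
  qed
  have in_count: "card {i \<in> {..k}. ?t i = v} = card (e ` {..k} \<inter> in_edges v)"
    if v: "v \<in> words A (n - m)" for v
  proof -
    have "e i \<in> in_edges v \<longleftrightarrow> ?t i = v" if "i \<le> k" for i
    proof
      assume "?t i = v"
      moreover have "take m (e i) \<in> words A m"
        using take_in_words[OF edge[OF that], of m] mn by simp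
      ultimately show "e i \<in> in_edges v"
        unfolding in_edges_def by (intro image_eqI[of _ _ "take m (e i)"]) auto
    qed (use v in \<open>auto simp: in_edges_def words_def\<close>)
    then have "e ` {..k} \<inter> in_edges v = e ` {i \<in> {..k}. ?t i = v}" by auto
    moreover have "inj_on e {i \<in> {..k}. ?t i = v}"
      using inj by (rule inj_on_subset) auto
    ultimately show ?thesis by (simp add: card_image)
  qed
  have balance: "card (e ` {..k} \<inter> in_edges v) + of_bool (?z = v)
      = card (e ` {..k} \<inter> out_edges v) + of_bool (?t k = v)" if "v \<in> words A (n - m)" for v
    using trail_balance[of k ?t ?s v] link start mn
    unfolding in_count[OF that] out_count[OF that] by (simp add: min_def)
  have stuck': "out_edges (?t k) \<subseteq> e ` {..k}"
    using stuck by (auto simp: out_edges_def)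
  have end_word: "?t k \<in> words A (n - m)"
    using drop_in_words[OF edge] by simp
  have closed: "?t k = ?z"
  proof (rule ccontr)
    assume "?t k \<noteq> ?z"
    \<comment> \<open>All \<open>card A ^ m\<close> edges out of the end vertex are used, and the
      last arrival adds one: more used incoming edges than there are.\<close>
    then have "card (e ` {..k} \<inter> in_edges (?t k)) = card A ^ m + 1"
      using balance[OF end_word] stuck' by (auto simp: Int_absorb1 card_edges)
    moreover have "card (e ` {..k} \<inter> in_edges (?t k)) \<le> card A ^ m"
      using card_mono[OF fin_edges(2), of "e ` {..k} \<inter> in_edges (?t k)" "?t k"]
      by (simp add: card_edges)
    ultimately show False by simp
  qed
  have in_from_out: "in_edges v \<subseteq> e ` {..k}"
    if "v \<in> words A (n - m)" "out_edges v \<subseteq> e ` {..k}" for v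
  proof -
    \<comment> \<open>On a closed trail the two \<open>of_bool\<close> terms of
      \<open>balance\<close> agree and cancel.\<close>
    have "card (e ` {..k} \<inter> in_edges v) = card (in_edges v)"
      using balance[OF that(1)] that(2) by (simp add: closed Int_absorb1 card_edges)
    then have "e ` {..k} \<inter> in_edges v = in_edges v"
      using card_subset_eq[OF fin_edges(2), of "e ` {..k} \<inter> in_edges v" v] by simp
    then show ?thesis by auto
  qed
  \<comment> \<open>The index \<open>j\<close> bounds the length of the shortest prefix of
    \<open>v\<close> after which only zeros follow; following the zero edge lowers it to
    \<open>j - m\<close>.\<close>
  have full: "out_edges v \<subseteq> e ` {..k}" if "v \<in> words A (n - m)" "set (drop j v) \<subseteq> {0}" for j v
    using that
  proof (induction j arbitrary: v rule: less_induct)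
    case (less j)
    show ?case
    proof (cases "v = ?z")
      case True
      then show ?thesis using stuck' closed by simp
    next
      case False
      have "j > 0"
      proof (rule ccontr)
        assume "\<not> j > 0"
        then have "set v \<subseteq> {0}" "length v = n - m"
          using less.prems by (auto simp: words_def)
        then show False using False by (metis replicate_eqI singletonD subsetD)
      qed
      define v' where "v' = drop m (v @ replicate m 0)"
      have edge_word: "v @ replicate m 0 \<in> words A n"
        using append_in_words[OF less.prems(1) replicate_in_words[OF zero, of m]] mn by simp
      then have v': "v' \<in> words A (n - m)"
        unfolding v'_def by (rule drop_in_words)
      \<comment> \<open>Dropping \<open>m\<close> and then \<open>j - m\<close> letters drops at
        least \<open>j\<close> letters, also when \<open>j < m\<close>.\<close>
      have "set (drop (j - m) v') \<subseteq> set (drop j (v @ replicate m 0))"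
        unfolding v'_def drop_drop by (rule set_drop_subset_set_drop) simp
      also have "\<dots> \<subseteq> {0}"
        using less.prems(2) by (auto dest: in_set_dropD)
      finally have "out_edges v' \<subseteq> e ` {..k}"
        using less.IH[of "j - m"] \<open>j > 0\<close> \<open>0 < m\<close> v' by simp
      then have "in_edges v' \<subseteq> e ` {..k}"
        using in_from_out v' by blast
      moreover have "v @ replicate m 0 \<in> in_edges v'"
        unfolding in_edges_def
        by (intro image_eqI[of _ _ "take m (v @ replicate m 0)"] take_in_words[OF edge_word])
          (use mn in \<open>simp_all add: v'_def del: take_append drop_append\<close>)
      ultimately show ?thesis
        using last[OF False] by (auto simp: out_edges_def)
    qed
  qed
  show ?thesis
  proof
    fix u assume u: "u \<in> words A n"
    have "take (n - m) u \<in> words A (n - m)"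
      by (rule take_in_words[OF u]) simp
    \<comment> \<open>With \<open>j = n\<close> nothing remains after the drop, so the condition on
      zeros is vacuous.\<close>
    then have "out_edges (take (n - m) u) \<subseteq> e ` {..k}"
      using full[of _ n] by (auto simp: words_def)
    moreover have "u \<in> out_edges (take (n - m) u)"
      unfolding out_edges_def using drop_in_words[OF u, of "n - m"] mn
      by (intro image_eqI[of _ _ "drop (n - m) u"]) auto
    ultimately show "u \<in> e ` {..k}" by blast
  qed
qed

section \<open>Factors at modulo \<open>m\<close> positions\<close>

definition factor :: "nat \<Rightarrow> nat \<Rightarrow> nat list \<Rightarrow> nat \<Rightarrow> nat list" where
  "factor m n w i = take n (drop (i * m) w)"

lemma occurs_at_iff_factor:
  assumes "m > 0" "length w = n + k * m" "length u = n"
  shows "occurs_at m u w i \<longleftrightarrow> i \<le> k \<and> factor m n w i = u"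
  using assms by (auto simp: occurs_at_def factor_def)

lemma appears_iff_factor:
  assumes "m > 0" "length w = n + k * m" "length u = n"
  shows "appears m u w \<longleftrightarrow> u \<in> factor m n w ` {..k}"
  using occurs_at_iff_factor[OF assms] by (auto simp: appears_def)

lemma factor_append:
  assumes "length w = n + k * m" "i \<le> k"
  shows "factor m n (w @ x) i = factor m n w i"
proof -
  have "i * m \<le> k * m" using assms(2) by (rule mult_le_mono1)
  then have "n \<le> length w - i * m" using assms(1) by linarith
  then show ?thesis by (simp add: factor_def)
qed

lemma factor_last:
  assumes "length w = n + k * m"
  shows "factor m n w k = suffix_of_length n w"
  using assms by (simp add: factor_def suffix_of_length_def)

lemma factor_link:
  "drop m (factor m n w i) = take (n - m) (factor m n w (Suc i))"
  by (simp add: factor_def drop_take add.commute)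

section \<open>The loop invariant\<close>

text \<open>After \<open>k\<close> appended blocks the trail has the edges \<open>0\<close> to
  \<open>k\<close>. The last clause exempts the zero vertex because the initial word already uses
  its zero edge.\<close>

definition greedy_inv :: "nat set \<Rightarrow> nat \<Rightarrow> nat \<Rightarrow> nat list \<Rightarrow> nat \<Rightarrow> bool" where
  "greedy_inv A m n w k \<longleftrightarrow>
     set w \<subseteq> A \<and> length w = n + k * m \<and> inj_on (factor m n w) {..k} \<and>
     factor m n w 0 = replicate n 0 \<and>
     (m < n \<longrightarrow> (\<forall>v x. v \<noteq> replicate (n - m) 0 \<longrightarrow> v @ replicate m 0 \<in> factor m n w ` {..k}
        \<longrightarrow> x \<in> words A m \<longrightarrow> v @ x \<in> factor m n w ` {..k}))"

lemma factor_in_words: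
  assumes "greedy_inv A m n w k" "i \<le> k"
  shows "factor m n w i \<in> words A n"
proof -
  have "i * m \<le> k * m" using assms(2) by (rule mult_le_mono1)
  then show ?thesis
    using assms(1) unfolding factor_def greedy_inv_def
    by (intro take_drop_in_words[of w A "length w"]) (auto simp: words_def)
qed

text \<open>The \<open>k + 1\<close> factors are distinct words of length \<open>n\<close>; this
  bound yields termination.\<close>

lemma greedy_inv_bound:
  assumes "finite A" "greedy_inv A m n w k"
  shows "k < card A ^ n"
proof -
  have "card (factor m n w ` {..k}) \<le> card (words A n)"
    using factor_in_words[OF assms(2)] assms(1) by (intro card_mono finite_words) auto
  moreover have "card (factor m n w ` {..k}) = Suc k"
    using assms(2) by (simp add: greedy_inv_def card_image)
  ultimately show ?thesis using assms(1) by (simp add: card_words)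
qed

text \<open>The only edge used so far leaves the zero vertex, so the last clause holds
  vacuously.\<close>

lemma greedy_inv_init:
  assumes "0 \<in> A"
  shows "greedy_inv A m n (replicate n 0) 0"
proof -
  have "v = replicate (n - m) 0" if "v @ replicate m 0 = replicate n (0::nat)" for v
  proof -
    have "length v = n - m" using arg_cong[OF that, of length] by simp
    then show ?thesis using arg_cong[OF that, of "take (n - m)"] by simp
  qed
  then show ?thesis
    using assms by (auto simp: greedy_inv_def factor_def)
qed

text \<open>In graph terms, the new edge leaves the target of the previous one.\<close>

lemma suffix_of_length_append:
  assumes "m < n" "n \<le> length w" "length x = m"
  shows "suffix_of_length n (w @ x) = drop m (suffix_of_length n w) @ x"
  using assms by (simp add: suffix_of_length_def add.commute)

lemma greedy_inv_step:
  assumes fin: "finite A" and "m > 0" and inv: "greedy_inv A m n w k"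
    and ne: "extensions A m n w \<noteq> {}"
  shows "greedy_inv A m n (greedy_step A m n w) (Suc k)"
proof -
  define x where "x = Max (extensions A m n w)"
  let ?F = "factor m n w ` {..k}" and ?w = "w @ x"
  have len: "length w = n + k * m" using inv by (simp add: greedy_inv_def)
  have fin_ext: "finite (extensions A m n w)"
    using finite_words[OF fin] by (simp add: extensions_def)
  have "x \<in> extensions A m n w"
    unfolding x_def using fin_ext ne by (rule Max_in)
  then have x: "x \<in> words A m" "\<not> appears m (suffix_of_length n ?w) w"
    by (auto simp: extensions_def)
  have len_x: "length x = m" using x(1) by (simp add: words_def)
  have len': "length ?w = n + Suc k * m" using len len_x by simp
  have old: "factor m n ?w i = factor m n w i" if "i \<le> k" for i
    by (rule factor_append[OF len that])
  have new: "factor m n ?w (Suc k) = suffix_of_length n ?w"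
    by (rule factor_last[OF len'])
  have img: "factor m n ?w ` {..Suc k} = insert (suffix_of_length n ?w) ?F"
    using old new by (force simp: atMost_Suc)
  have len_suffix: "length (suffix_of_length n (w @ y)) = n" for y
    using len by (simp add: suffix_of_length_def)
  have fresh: "suffix_of_length n ?w \<notin> ?F"
    using x(2) appears_iff_factor[OF \<open>m > 0\<close> len len_suffix] by simp
  have "inj_on (factor m n ?w) {..k}"
    using inv inj_on_cong[of "{..k}" "factor m n ?w" "factor m n w"] old by (auto simp: greedy_inv_def)
  then have inj: "inj_on (factor m n ?w) {..Suc k}"
    using fresh new old by (auto simp: atMost_Suc)
  have "v @ y \<in> factor m n ?w ` {..Suc k}"
    if mn: "m < n" and v: "v \<noteq> replicate (n - m) 0"
      and used: "v @ replicate m 0 \<in> factor m n ?w ` {..Suc k}" and y: "y \<in> words A m" for v y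
  proof (cases "v @ replicate m 0 \<in> ?F")
    case True
    then show ?thesis using inv mn v y img by (auto simp: greedy_inv_def)
  next
    case False
    \<comment> \<open>The zero edge out of \<open>v\<close> is the one just added, so the maximal
      extension is the zero block. Any other \<open>y\<close> is larger, hence no extension, hence
      already used after \<open>v\<close>.\<close>
    then have "v @ replicate m 0 = suffix_of_length n ?w"
      using used img by simp
    then have vx: "v = drop m (suffix_of_length n w)" "x = replicate m 0"
      using suffix_of_length_append[OF mn _ len_x] len len_x by auto
    have y_suffix: "suffix_of_length n (w @ y) = v @ y"
      using suffix_of_length_append[OF mn, of w y] len y vx(1) by (simp add: words_def)
    show ?thesis
    proof (cases "y = x")
      case True
      then show ?thesis using used vx(2) by simp
    next
      case False
      have "x \<le> y" using replicate_0_le[of y] y vx(2) by (simp add: words_def)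
      then have "y \<notin> extensions A m n w"
        using False Max_ge[OF fin_ext, of y] unfolding x_def by force
      then have "v @ y \<in> ?F"
        using y y_suffix appears_iff_factor[OF \<open>m > 0\<close> len len_suffix, of y]
        by (simp add: extensions_def)
      then show ?thesis using img by simp
    qed
  qed
  moreover have "set ?w \<subseteq> A" "factor m n ?w 0 = replicate n 0"
    using inv x(1) old[of 0] by (auto simp: greedy_inv_def words_def)
  ultimately show ?thesis
    using inj len' unfolding greedy_inv_def greedy_step_def x_def[symmetric] by blast
qed

section \<open>The word at termination\<close>

lemma stuck_covers:
  assumes fin: "finite A" and zero: "0 \<in> A" and "m > 0" and inv: "greedy_inv A m n w k"
    and stuck: "extensions A m n w = {}"
  shows "words A n \<subseteq> factor m n w ` {..k}"
proof -
  have len: "length w = n + k * m" using inv by (simp add: greedy_inv_def)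
  have used: "suffix_of_length n (w @ x) \<in> factor m n w ` {..k}" if "x \<in> words A m" for x
  proof -
    have "length (suffix_of_length n (w @ x)) = n"
      using len by (simp add: suffix_of_length_def)
    then show ?thesis
      using stuck that appears_iff_factor[OF \<open>m > 0\<close> len] by (auto simp: extensions_def)
  qed
  show ?thesis
  proof (cases "m < n")
    case True
    have "drop m (factor m n w k) @ x \<in> factor m n w ` {..k}" if "x \<in> words A m" for x
      using used[OF that] suffix_of_length_append[OF True, of w x] that len
      by (simp add: words_def factor_last)
    then show ?thesis
      using fin zero \<open>m > 0\<close> True inv factor_in_words[OF inv]
      by (intro greedy_trail_covers[of A m n]) (auto simp: greedy_inv_def factor_link)
  next
    case False
    show ?thesis
    proof
      fix u assume u: "u \<in> words A n"
      \<comment> \<open>For \<open>n \<le> m\<close> the new suffix lies inside the appended block;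
        padding \<open>u\<close> on the left with zeros gives a block ending in
        \<open>u\<close>.\<close>
      have "replicate (m - n) 0 @ u \<in> words A m"
        using append_in_words[OF replicate_in_words[OF zero, of "m - n"] u] False by simp
      from used[OF this] show "u \<in> factor m n w ` {..k}"
        using u by (simp add: suffix_of_length_def words_def)
    qed
  qed
qed

text \<open>Injectivity and covering make \<open>factor m n w\<close> a bijection from
  \<open>{..k}\<close> onto the words of length \<open>n\<close>. Thus
  \<open>k + 1 = card A ^ n\<close>, which fixes the length.\<close>

lemma stuck_shift_de_bruijn:
  assumes fin: "finite A" and "0 \<in> A" and "m > 0" and inv: "greedy_inv A m n w k"
    and "extensions A m n w = {}"
  shows "shift_de_bruijn A m n w"
proof -
  have len: "length w = n + k * m" and inj: "inj_on (factor m n w) {..k}"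
    using inv by (auto simp: greedy_inv_def)
  have cover: "factor m n w ` {..k} = words A n"
    using stuck_covers[OF assms] factor_in_words[OF inv] by auto
  have "Suc k = card A ^ n"
    using card_image[OF inj] cover card_words[OF fin, of n] by simp
  then have "int (card A) ^ n = int k + 1"
    by (metis of_nat_Suc of_nat_power add.commute)
  then have "int (length w) = int m * int (card A) ^ n + (int n - int m)"
    using len by (simp add: algebra_simps)
  moreover have "\<exists>!i. occurs_at m u w i" if u: "u \<in> words A n" for u
  proof -
    have "occurs_at m u w i \<longleftrightarrow> i \<le> k \<and> factor m n w i = u" for i
      using u by (intro occurs_at_iff_factor[OF \<open>m > 0\<close> len]) (simp add: words_def)
    moreover obtain i where "i \<le> k" "factor m n w i = u"
      using u cover by (metis atMost_iff imageE)
    ultimately show ?thesis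
      using inj by (intro ex1I[of _ i]) (auto simp: inj_on_def)
  qed
  ultimately show ?thesis
    using inv by (simp add: shift_de_bruijn_def greedy_inv_def)
qed

theorem mainTheorem4:
  fixes \<Sigma> :: "nat set" and m n :: nat
  assumes "finite \<Sigma>" and "0 \<in> \<Sigma>" and "m > 0" and "n > 0"
  shows "\<exists>w. greedy_algorithm \<Sigma> m n = Some w \<and> shift_de_bruijn \<Sigma> m n w"
proof -
  let ?inv = "\<lambda>w. \<exists>k. greedy_inv \<Sigma> m n w k"
  have init: "?inv (replicate n 0)"
    using greedy_inv_init[OF assms(2)] by blast
  have step: "?inv (greedy_step \<Sigma> m n w)" if "?inv w" "extensions \<Sigma> m n w \<noteq> {}" for w
    using that greedy_inv_step[OF assms(1,3)] by blast
  have decrease: "n + card \<Sigma> ^ n * m - length (greedy_step \<Sigma> m n w) < n + card \<Sigma> ^ n * m - length w"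
    if w: "?inv w" and ne: "extensions \<Sigma> m n w \<noteq> {}" for w
  proof -
    obtain k where k: "greedy_inv \<Sigma> m n w k" using w by blast
    then have "greedy_inv \<Sigma> m n (greedy_step \<Sigma> m n w) (Suc k)"
      by (rule greedy_inv_step[OF assms(1,3) _ ne])
    then have "length (greedy_step \<Sigma> m n w) = n + Suc k * m"
      by (simp add: greedy_inv_def)
    moreover have "length w = n + k * m"
      using k by (simp add: greedy_inv_def)
    \<comment> \<open>Subtraction on naturals truncates at zero, so the measure strictly decreases
      only because it is still positive before the step.\<close>
    moreover have "k * m < card \<Sigma> ^ n * m"
      using greedy_inv_bound[OF assms(1) k] \<open>m > 0\<close> by simp
    ultimately show ?thesis using \<open>m > 0\<close> by (simp add: diff_less_mono2)
  qed
  obtain w where w: "greedy_algorithm \<Sigma> m n = Some w"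
    unfolding greedy_algorithm_def
    using measure_while_option_Some[where P = ?inv and f = "\<lambda>w. n + card \<Sigma> ^ n * m - length w"
        and b = "\<lambda>w. extensions \<Sigma> m n w \<noteq> {}" and c = "greedy_step \<Sigma> m n" and s = "replicate n 0"]
      init step decrease by blast
  have "?inv w"
    using while_option_rule[where P = ?inv, OF step w[unfolded greedy_algorithm_def] init] by blast
  moreover have "extensions \<Sigma> m n w = {}"
    using while_option_stop[OF w[unfolded greedy_algorithm_def]] by blast
  ultimately show ?thesis
    using stuck_shift_de_bruijn[OF assms(1,2,3)] w by blast
qed

end
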